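(* Let $G$ be a graph with $n$ vertices and let $q$ be a configuration of $n+1$ points (including the origin, as the position of the cone joint $o$) in $\mathbb{E}^{d+1}$ such that the projection $\pi(q)$ from the origin, through the hyperplane $x_{d+1}=1$ and back to $\mathbb{E}^{d}$, is equal to $p \in \mathbb{E}^{dn}$. Let $S$ be a symmetry group in dimension $d$. (i) The configuration $p\in \mathbb{E}^{dn}$ is a regular point of $G$ if and only if $q\in\mathbb{E}^{(d+1)(n+1)}$ is a regular point of $G*o$, where the cone joint is fixed at the origin. (ii) If $(G,p)\in\mathscr{R}_{(G,S)}$ and $(G*o,q)\in\mathscr{R}_{(G*o,S^* )}$, then $p$ is an $S$-regular point of $G$ if and only if $q$ is an $S^{*}$-regular point of $G*o$, where the cone joint is fixed at the origin. (iii) If $(G,p)\in\mathscr{R}_{(G,S)}$ and $(G*o,q)\in\mathscr{R}_{(G*o,S^* )}$, where $q\in \mathbb{S}_{+}^{d}$ (that is, all joints of $G$ lie in $\mathbb{S}^d_+$), then $p$ is an $S$-regular point of $G$ if and only if $q$ is an $S^{*}$-regular point of $G$ (on the sphere), where the cone joint is fixed at the origin.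
   Context: A framework $(G,p)$ in $\mathbb{E}^d$ is a finite simple graph $G$ with vertex set $V(G)=\{1,\dots,n\}$ and edge set $E(G)$, together with an injective map $p:V(G)\to\mathbb{E}^d$, identified with a point (configuration) of $\mathbb{E}^{dn}$; $p_i=p(i)$. The edge function is $f_G:\mathbb{E}^{dn}\to\mathbb{R}^{|E(G)|}$, $f_G(p)=(\|p_i-p_j\|^2)_{\{i,j\}\in E(G)}$, and the rigidity matrix is $\mathbf{R}(G,p)=\tfrac12 df_G(p)$. A configuration $p$ is a regular point of $G$ if $\operatorname{rank}\mathbf{R}(G,p)\ge\operatorname{rank}\mathbf{R}(G,p')$ for all $p'\in\mathbb{E}^{dn}$. A symmetry group in dimension $d$ is a subgroup $S$ of $O(\mathbb{E}^d)$. $\mathscr{R}_{(G,S)}$ is the set of frameworks $(G,p)$ in $\mathbb{E}^d$ for which there is a map $\Phi:S\to\mathrm{Aut}(G)$ with $x(p_i)=p_{\Phi(x)(i)}$ for all $i\in V(G)$, $x\in S$; $\Phi$, called the type of $(G,p)$, is unique and a homomorphism since $p$ is injective. $\mathscr{P}_{(G,S,\Phi)}$ is the linear subspace of all configurations in $\mathbb{E}^{dn}$ satisfying these equations, and $\tilde f_G$ is the restriction of $f_G$ to it. For $(G,p)\in\mathscr{R}_{(G,S)}$ of type $\Phi$, $p$ is an $S$-regular point of $G$ if $\operatorname{rank} d\tilde f_G(p)=\max\{\operatorname{rank} d\tilde f_G(p'):p'\in\mathscr{P}_{(G,S,\Phi)}\}$. For $x\in S$ with matrix $M_x$, $x^*$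 is the transformation of $\mathbb{E}^{d+1}$ with matrix $\begin{pmatrix}M_x&0\\0&1\end{pmatrix}$, and $S^*=\{x^*:x\in S\}$. The cone graph $G*o$ is $G$ with a new vertex $o$ joined to all vertices of $G$. In $(G*o,q)$ the joint $o$ is at the origin. The condition $\pi(q)=p$ means that for each $i\in V(G)$ there is a scalar $\alpha_i\ne0$ with $q_i=\alpha_i(p_i,1)$. "Where the cone joint is fixed at the origin" means that in the definition of regular ($S^*$-regular) point of $G*o$, the edge function $f_{G*o}$ is regarded as a function on the configurations (respectively the configurations in $\mathscr{P}_{(G*o,S^*,\Phi^* )}$, with $\Phi^*$ the type of $(G*o,q)$) in $\mathbb{E}^{d+1}$ whose cone joint is at the origin, and ranks of its differential are compared among these configurations. $\mathbb{S}^d$ is the unit sphere centered at the origin in $\mathbb{E}^{d+1}$ and $\mathbb{S}^d_+=\{a\in\mathbb{S}^d:a_{d+1}>0\}$. A framework on the sphere is modelled as the cone framework with cone joint at the center: in (iii), $q$ is an $S^*$-regular point of $G$ on the sphere if the rank at $q$ of the differential of the edge function $f_{G*o}$, regarded as a function on the configurations in $\mathscr{P}_{(G*o,S^*,\Phi^* )}$ with cone joint at the origin, is maximal among all configurations in $\mathscr{P}_{(G*o,S^*,\Phi^* )}$ with cone joint at the origin and all other joints on $\mathbb{S}^d$. *)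

theory Defs
  imports "HOL-Analysis.Analysis"
begin

text \<open>
  Graphs have a finite type \<open>'v\<close> as vertex set and a set \<open>E\<close> of two-element subsets of it as
  edge set. A configuration in \<open>'a\<close> is a point of the Euclidean space \<open>'a ^ 'v\<close>.
\<close>

definition simple_graph :: "'v set set \<Rightarrow> bool" where
  "simple_graph E \<longleftrightarrow> (\<forall>e\<in>E. card e = 2)"

definition graph_aut :: "'v set set \<Rightarrow> ('v \<Rightarrow> 'v) set" where
  "graph_aut E = {\<sigma>. bij \<sigma> \<and> (\<forall>i j. {\<sigma> i, \<sigma> j} \<in> E \<longleftrightarrow> {i, j} \<in> E)}"

text \<open>The vertex \<open>None\<close> is the cone joint.\<close>

definition cone_graph :: "'v set set \<Rightarrow> 'v option set set" where
  "cone_graph E = (`) Some ` E \<union> {{None, Some i} | i. True}"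

definition edge_sqlen :: "'a::euclidean_space ^ 'v::finite \<Rightarrow> 'v set \<Rightarrow> real" where
  "edge_sqlen p e = (THE r. \<exists>i j. e = {i, j} \<and> r = (norm (p $ i - p $ j))\<^sup>2)"

lemma edge_sqlen_doubleton: "edge_sqlen p {i, j} = (norm (p $ i - p $ j))\<^sup>2"
  unfolding edge_sqlen_def
  by (rule the_equality) (auto simp: doubleton_eq_iff norm_minus_commute)

text \<open>
  The codomain \<open>\<real>\<^sup>E\<close> is realised as the coordinate subspace of \<open>real ^ 'v set\<close> of vectors that
  vanish outside \<open>E\<close>; the additional zero coordinates do not affect ranks.
\<close>

definition edge_fun :: "'v::finite set set \<Rightarrow> 'a::euclidean_space ^ 'v \<Rightarrow> real ^ 'v set" where
  "edge_fun E p = (\<chi> e. if e \<in> E then edge_sqlen p e else 0)"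

text \<open>The rigidity matrix, as a linear map.\<close>

definition rigidity_map ::
    "'v::finite set set \<Rightarrow> 'a::euclidean_space ^ 'v \<Rightarrow> 'a ^ 'v \<Rightarrow> real ^ 'v set" where
  "rigidity_map E p = (\<lambda>u. (1/2) *\<^sub>R frechet_derivative (edge_fun E) (at p) u)"

definition regular_point :: "'v::finite set set \<Rightarrow> 'a::euclidean_space ^ 'v \<Rightarrow> bool" where
  "regular_point E p \<longleftrightarrow>
     (\<forall>p' :: 'a ^ 'v. dim (range (rigidity_map E p')) \<le> dim (range (rigidity_map E p)))"

text \<open>
  For a linear subspace \<open>W\<close> and \<open>p \<in> W\<close>, this is the rank of the differential at \<open>p\<close> of the
  restriction of \<open>f\<close> to \<open>W\<close>. The derivative within \<open>W\<close> is determined only on \<open>W\<close>, so it is the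
  image of \<open>W\<close> that has to be taken.
\<close>

definition rank_diff_on ::
    "'b::euclidean_space set \<Rightarrow> ('b \<Rightarrow> 'c::euclidean_space) \<Rightarrow> 'b \<Rightarrow> nat" where
  "rank_diff_on W f p = dim (frechet_derivative f (at p within W) ` W)"

definition symmetry_group :: "('a::euclidean_space \<Rightarrow> 'a) set \<Rightarrow> bool" where
  "symmetry_group S \<longleftrightarrow>
     S \<subseteq> {x. orthogonal_transformation x} \<and> id \<in> S \<and>
     (\<forall>x\<in>S. \<forall>y\<in>S. x \<circ> y \<in> S) \<and> (\<forall>x\<in>S. inv x \<in> S)"

text \<open>
  The type maps are taken in the extensional function space, so that they are unique as
  functions; see \<open>framework_type_unique\<close> below.
\<close>

definition is_framework_type ::
    "'v::finite set set \<Rightarrow> ('a::euclidean_space \<Rightarrow> 'a) set \<Rightarrow> 'a ^ 'v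
     \<Rightarrow> (('a \<Rightarrow> 'a) \<Rightarrow> 'v \<Rightarrow> 'v) \<Rightarrow> bool" where
  "is_framework_type E S p \<Phi> \<longleftrightarrow>
     \<Phi> \<in> S \<rightarrow>\<^sub>E graph_aut E \<and> (\<forall>x\<in>S. \<forall>i. x (p $ i) = p $ \<Phi> x i)"

definition sym_frameworks ::
    "'v::finite set set \<Rightarrow> ('a::euclidean_space \<Rightarrow> 'a) set \<Rightarrow> ('a ^ 'v) set" where
  "sym_frameworks E S = {p. inj (($) p) \<and> (\<exists>\<Phi>. is_framework_type E S p \<Phi>)}"

lemma framework_type_unique:
  assumes "p \<in> sym_frameworks E S"
  shows "\<exists>!\<Phi>. is_framework_type E S p \<Phi>"
proof -
  have inj: "inj (($) p)" using assms by (simp add: sym_frameworks_def)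
  have "\<Phi> = \<Psi>" if \<Phi>: "is_framework_type E S p \<Phi>" and \<Psi>: "is_framework_type E S p \<Psi>" for \<Phi> \<Psi>
  proof (rule PiE_ext)
    show "\<Phi> \<in> S \<rightarrow>\<^sub>E graph_aut E" "\<Psi> \<in> S \<rightarrow>\<^sub>E graph_aut E"
      using \<Phi> \<Psi> by (simp_all add: is_framework_type_def)
    fix x assume "x \<in> S"
    then have "p $ \<Phi> x i = p $ \<Psi> x i" for i
      using \<Phi> \<Psi> unfolding is_framework_type_def by metis
    then show "\<Phi> x = \<Psi> x" using inj by (auto dest: injD)
  qed
  then show ?thesis using assms unfolding sym_frameworks_def by blast
qed

definition framework_type ::
    "'v::finite set set \<Rightarrow> ('a::euclidean_space \<Rightarrow> 'a) set \<Rightarrow> 'a ^ 'v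
     \<Rightarrow> ('a \<Rightarrow> 'a) \<Rightarrow> 'v \<Rightarrow> 'v" where
  "framework_type E S p = (THE \<Phi>. is_framework_type E S p \<Phi>)"

definition sym_configs ::
    "('a::euclidean_space \<Rightarrow> 'a) set \<Rightarrow> (('a \<Rightarrow> 'a) \<Rightarrow> 'v \<Rightarrow> 'v) \<Rightarrow> ('a ^ 'v::finite) set" where
  "sym_configs S \<Phi> = {p. \<forall>x\<in>S. \<forall>i. x (p $ i) = p $ \<Phi> x i}"

definition sym_regular_point ::
    "'v::finite set set \<Rightarrow> ('a::euclidean_space \<Rightarrow> 'a) set \<Rightarrow> 'a ^ 'v \<Rightarrow> bool" where
  "sym_regular_point E S p \<longleftrightarrow>
     (let P = sym_configs S (framework_type E S p)
      in \<forall>p'\<in>P. rank_diff_on P (edge_fun E) p' \<le> rank_diff_on P (edge_fun E) p)"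

text \<open>
  The space of dimension \<open>d + 1\<close> is \<open>'a \<times> real\<close>, with the last coordinate as second component.
  The block matrix with blocks \<open>M\<close> and \<open>1\<close> is the map \<open>(a, t) \<mapsto> (M a, t)\<close>.
\<close>

definition star_group :: "('a \<Rightarrow> 'a) set \<Rightarrow> ('a \<times> real \<Rightarrow> 'a \<times> real) set" where
  "star_group S = (\<lambda>x. map_prod x id) ` S"

definition cone_projects_to ::
    "('a::euclidean_space \<times> real) ^ ('v::finite option) \<Rightarrow> 'a ^ 'v \<Rightarrow> bool" where
  "cone_projects_to q p \<longleftrightarrow>
     q $ None = 0 \<and> (\<forall>i. \<exists>\<alpha>. \<alpha> \<noteq> 0 \<and> q $ Some i = \<alpha> *\<^sub>R (p $ i, 1))"

definition origin_configs :: "('b::euclidean_space ^ ('v::finite option)) set" where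
  "origin_configs = {q. q $ None = 0}"

text \<open>
  The regularity notions for \<open>cone_graph E\<close> with the cone joint fixed at the origin; \<open>T\<close> is the
  symmetry group acting on the space containing \<open>q\<close>. On the sphere, the edge function is still
  differentiated along all of \<open>W\<close>, and only the configurations compared are restricted to the
  sphere.
\<close>

definition cone_regular_point ::
    "'v::finite set set \<Rightarrow> 'b::euclidean_space ^ ('v option) \<Rightarrow> bool" where
  "cone_regular_point E q \<longleftrightarrow>
     (let W = origin_configs; r = rank_diff_on W (edge_fun (cone_graph E))
      in \<forall>q'\<in>W. r q' \<le> r q)"

definition cone_sym_regular_point ::
    "'v::finite set set \<Rightarrow> ('b::euclidean_space \<Rightarrow> 'b) set \<Rightarrow> 'b ^ ('v option) \<Rightarrow> bool" where
  "cone_sym_regular_point E T q \<longleftrightarrow>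
     (let W = sym_configs T (framework_type (cone_graph E) T q) \<inter> origin_configs;
          r = rank_diff_on W (edge_fun (cone_graph E))
      in \<forall>q'\<in>W. r q' \<le> r q)"

definition sphere_sym_regular_point ::
    "'v::finite set set \<Rightarrow> ('b::euclidean_space \<Rightarrow> 'b) set \<Rightarrow> 'b ^ ('v option) \<Rightarrow> bool" where
  "sphere_sym_regular_point E T q \<longleftrightarrow>
     (let W = sym_configs T (framework_type (cone_graph E) T q) \<inter> origin_configs;
          r = rank_diff_on W (edge_fun (cone_graph E))
      in \<forall>q'\<in>W. (\<forall>i. q' $ Some i \<in> sphere 0 1) \<longrightarrow> r q' \<le> r q)"

definition upper_sphere :: "('a::euclidean_space \<times> real) set" where
  "upper_sphere = {a \<in> sphere 0 1. snd a > 0}"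

end

theory Submission
  imports Defs
begin

text \<open>
  Coning is a statement about infinitesimal flexes. Let \<open>q\<^sub>i = \<alpha>\<^sub>i (p\<^sub>i, 1)\<close> with \<open>\<alpha>\<^sub>i \<noteq> 0\<close>. A velocity
  \<open>u\<close> of the cone framework with \<open>u\<^sub>o = 0\<close> preserves the cone edges to first order iff
  \<open>q\<^sub>i \<bullet> u\<^sub>i = 0\<close> for all \<open>i\<close>, that is, iff \<open>u\<^sub>i = \<alpha>\<^sub>i (w\<^sub>i, - p\<^sub>i \<bullet> w\<^sub>i)\<close> for some \<open>w\<^sub>i\<close>. The condition
  at an edge \<open>{i, j}\<close> of \<open>G\<close> then becomes \<open>\<alpha>\<^sub>i \<alpha>\<^sub>j (p\<^sub>i - p\<^sub>j) \<bullet> (w\<^sub>i - w\<^sub>j) = 0\<close>. So \<open>w \<mapsto> u\<close> is a linear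
  isomorphism from the infinitesimal flexes of \<open>(G, p)\<close> onto those of \<open>(G*o, q)\<close>. Because elements
  of the symmetry group are orthogonal and the scalars \<open>\<alpha>\<^sub>i\<close> are constant on its orbits, the
  isomorphism matches the symmetric flexes. By rank-nullity the ranks at \<open>p\<close> and at
  \<open>q\<close> then differ by a constant, the difference of the dimensions of the two
  configuration spaces (\<open>cone_rank\<close>).

  Every symmetric configuration \<open>p'\<close> of \<open>G\<close> lifts to the symmetric cone configuration
  \<open>(p'\<^sub>i, 1)\<close>, and also to its normalisation on the sphere; hence a maximum of the rank on the cone
  side, even one taken only over the sphere, yields a maximum at \<open>p\<close>. For the
  converse, a cone configuration need not project to \<open>G\<close>, since some of its last coordinates may
  vanish. Adding the same small \<open>\<epsilon>\<close> to all the last coordinates repairs this, keeps the symmetry,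
  and does not lower the rank, by lower semicontinuity (\<open>rank_bilinear_lower_semicontinuous\<close>).
  The version without symmetry is the case of the empty set of symmetry constraints.
\<close>

section \<open>Rank-nullity and semicontinuity of the rank on a subspace\<close>

lemma kernel_complement_exists:
  fixes f :: "'a::euclidean_space \<Rightarrow> 'b::euclidean_space"
  assumes "linear f" and W: "subspace W"
  obtains U where "subspace U" "U \<subseteq> W" "inj_on f U" "f ` U = f ` W"
    "dim U + dim {w\<in>W. f w = 0} = dim W"
proof -
  interpret f: linear f by fact
  define K where "K = {w\<in>W. f w = 0}"
  define U where "U = {y\<in>W. \<forall>x\<in>K. orthogonal x y}"
  have K: "subspace K" "K \<subseteq> W"
    using W by (auto simp: K_def subspace_def f.add f.scale)
  have U: "subspace U" "U \<subseteq> W"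
    using W by (auto simp: U_def subspace_def orthogonal_def inner_simps)
  have inj: "inj_on f U"
  proof (rule inj_onI)
    fix x y assume xy: "x \<in> U" "y \<in> U" "f x = f y"
    then have "x - y \<in> U" using U by (simp add: subspace_diff)
    moreover have "x - y \<in> K"
      using xy U W by (auto simp: K_def f.diff subspace_diff)
    ultimately show "x = y" by (auto simp: U_def orthogonal_def)
  qed
  have "f w \<in> f ` U" if "w \<in> W" for w
  proof -
    obtain y z where yz: "y \<in> span K" "\<And>v. v \<in> span K \<Longrightarrow> orthogonal z v" "w = y + z"
      using orthogonal_subspace_decomp_exists[of K w] by metis
    have y: "y \<in> K" using yz(1) K(1) by (simp add: span_eq_iff[THEN iffD2])
    have "z = w - y" using yz(3) by simp
    then have "z \<in> W" using that y K W by (auto intro: subspace_diff)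
    then have "z \<in> U"
      using yz(2) by (auto simp: U_def orthogonal_commute span_base)
    moreover have "f w = f z" using y by (simp add: yz(3) f.add K_def)
    ultimately show ?thesis by blast
  qed
  then have "f ` U = f ` W" using U by blast
  moreover have "dim U + dim K = dim W"
    unfolding U_def using dim_subspace_orthogonal_to_vectors[OF K(1) W K(2)] .
  ultimately show ?thesis using that U inj by (auto simp: K_def)
qed

lemma rank_nullity_on:
  fixes f :: "'a::euclidean_space \<Rightarrow> 'b::euclidean_space"
  assumes "linear f" "subspace W"
  shows "dim (f ` W) + dim {w\<in>W. f w = 0} = dim W"
proof -
  obtain U where U: "subspace U" "inj_on f U" "f ` U = f ` W"
    "dim U + dim {w\<in>W. f w = 0} = dim W"
    using kernel_complement_exists[OF assms] by metis
  have "dim (f ` U) = dim U"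
    using U by (intro dim_image_eq assms(1)) (simp add: span_eq_iff[THEN iffD2])
  then show ?thesis using U by simp
qed

text \<open>
  On a complement of the kernel, \<open>B a\<close> is bounded below by some \<open>e > 0\<close>, and a perturbation of
  operator norm less than \<open>e\<close> leaves it injective there.
\<close>

lemma rank_bilinear_lower_semicontinuous:
  fixes B :: "'a::euclidean_space \<Rightarrow> 'b::euclidean_space \<Rightarrow> 'c::euclidean_space"
  assumes B: "bounded_bilinear B" and W: "subspace W"
  shows "\<exists>\<delta>>0. \<forall>c. norm c < \<delta> \<longrightarrow> dim (B a ` W) \<le> dim (B (a + c) ` W)"
proof -
  interpret B: bounded_bilinear B by fact
  have lin: "linear (B x)" for x
    using B.bounded_linear_right bounded_linear.linear by blast
  obtain U where U: "subspace U" "U \<subseteq> W" "inj_on (B a) U" "B a ` U = B a ` W"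
    using kernel_complement_exists[OF lin W] by metis
  have "\<forall>x\<in>U. B a x = 0 \<longrightarrow> x = 0"
    using U(1,3) by (metis B.zero_right inj_onD subspace_0)
  then obtain e where e: "e > 0" "\<forall>x\<in>U. norm (B a x) \<ge> e * norm x"
    using injective_imp_isometric[OF closed_subspace[OF U(1)] U(1) B.bounded_linear_right] by blast
  obtain M where M: "M > 0" "\<And>x y. norm (B x y) \<le> norm x * norm y * M"
    using B.pos_bounded by blast
  have "dim (B a ` W) \<le> dim (B (a + c) ` W)" if c: "norm c < e / M" for c
  proof -
    have "x = 0" if x: "x \<in> U" "B (a + c) x = 0" for x
    proof (rule ccontr)
      assume "x \<noteq> 0"
      have "B a x = - B c x" using x(2) by (simp add: B.add_left eq_neg_iff_add_eq_0)
      then have "e * norm x \<le> norm (B c x)" using e(2) x(1) by (metis norm_minus_cancel)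
      also have "\<dots> \<le> (norm c * M) * norm x" using M(2)[of c x] by (simp add: mult_ac)
      finally have "e \<le> norm c * M" using \<open>x \<noteq> 0\<close> by simp
      then show False using c M(1) by (simp add: pos_less_divide_eq)
    qed
    then have "inj_on (B (a + c)) U"
      using U(1) by (intro inj_onI) (metis B.diff_right eq_iff_diff_eq_0 subspace_diff)
    then have "dim (B (a + c) ` U) = dim U"
      using U(1) by (intro dim_image_eq lin) (simp add: span_eq_iff[THEN iffD2])
    moreover have "dim (B a ` W) \<le> dim U" using dim_image_le[OF lin, of a U] U(4) by simp
    moreover have "dim (B (a + c) ` U) \<le> dim (B (a + c) ` W)"
      using U(2) by (intro dim_subset image_mono)
    ultimately show ?thesis by linarith
  qed
  then show ?thesis using e(1) M(1) by (intro exI[of _ "e / M"]) auto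
qed

section \<open>The differential of the edge function\<close>

text \<open>Along directions of the subspace, a derivative within a subspace is unique.\<close>

lemma rank_diff_on_eq:
  fixes f :: "'b::euclidean_space \<Rightarrow> 'c::euclidean_space"
  assumes f: "(f has_derivative D) (at p)" and W: "subspace W" and p: "p \<in> W"
  shows "rank_diff_on W f p = dim (D ` W)"
proof -
  let ?F = "frechet_derivative f (at p within W)"
  have D: "(f has_derivative D) (at p within W)"
    using f by (rule has_derivative_at_withinI)
  then have F: "(f has_derivative ?F) (at p within W)"
    using frechet_derivative_works differentiableI by blast
  have "?F w = D w" if w: "w \<in> W" for w
  proof -
    \<comment> \<open>Both are the derivative of \<open>f\<close> along the line through \<open>p\<close> in direction \<open>w\<close>, which lies in \<open>W\<close>.\<close>
    let ?l = "\<lambda>t::real. p + t *\<^sub>R w"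
    have line: "((\<lambda>t. f (?l t)) has_derivative (\<lambda>t. H (t *\<^sub>R w))) (at 0)"
      if "(f has_derivative H) (at p within W)" for H
    proof -
      have "range ?l \<subseteq> W" using W p w by (auto simp: subspace_add subspace_scale)
      then have "(f has_derivative H) (at (?l 0) within range ?l)"
        using that by (auto intro: has_derivative_subset)
      moreover have "(?l has_derivative (\<lambda>t. t *\<^sub>R w)) (at 0)"
        by (auto intro!: derivative_eq_intros)
      ultimately show ?thesis by (rule has_derivative_in_compose[rotated])
    qed
    have "(\<lambda>t. ?F (t *\<^sub>R w)) = (\<lambda>t. D (t *\<^sub>R w))"
      using has_derivative_unique[OF line[OF F] line[OF D]] .
    from fun_cong[OF this, of 1] show ?thesis by simp
  qed
  then show ?thesis by (simp add: rank_diff_on_def cong: image_cong)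
qed

text \<open>
  The polarisation of the quadratic map \<open>edge_fun E\<close>; the differential of \<open>edge_fun E\<close> at \<open>p\<close>
  is \<open>edge_form E p\<close>.
\<close>

definition edge_form ::
    "'v::finite set set \<Rightarrow> 'a::euclidean_space ^ 'v \<Rightarrow> 'a ^ 'v \<Rightarrow> real ^ 'v set" where
  "edge_form E p u = edge_fun E (p + u) - edge_fun E p - edge_fun E u"

lemma edge_form_edge:
  assumes "{i, j} \<in> E"
  shows "edge_form E p u $ {i, j} = 2 * ((p $ i - p $ j) \<bullet> (u $ i - u $ j))"
  using assms
  by (simp add: edge_form_def edge_fun_def edge_sqlen_doubleton power2_norm_eq_inner
      inner_simps inner_commute algebra_simps)

lemma edge_form_nonedge: "e \<notin> E \<Longrightarrow> edge_form E p u $ e = 0"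
  by (simp add: edge_form_def edge_fun_def)

text \<open>Edge-indexed vectors are compared on pairs, where \<open>edge_sqlen\<close> has an explicit formula.\<close>

lemma simple_graph_eqI:
  assumes "simple_graph E"
    and "\<And>i j. {i, j} \<in> E \<Longrightarrow> x $ {i, j} = y $ {i, j}"
    and "\<And>e. e \<notin> E \<Longrightarrow> x $ e = y $ e"
  shows "x = y"
proof (rule vec_eq_iff[THEN iffD2, rule_format])
  fix e
  show "x $ e = y $ e"
    using assms by (cases "e \<in> E") (auto simp: simple_graph_def card_2_iff)
qed

lemma bounded_bilinear_edge_form:
  assumes "simple_graph E"
  shows "bounded_bilinear (edge_form E :: 'a::euclidean_space ^ 'v::finite \<Rightarrow> _)"
proof -
  have "bilinear (edge_form E :: 'a ^ 'v \<Rightarrow> _)"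
    unfolding bilinear_def
    by (auto intro!: linearI simple_graph_eqI[OF assms]
        simp: edge_form_edge edge_form_nonedge inner_simps algebra_simps)
  then show ?thesis by (simp add: bilinear_conv_bounded_bilinear)
qed

lemma edge_form_self:
  assumes "simple_graph E"
  shows "edge_fun E p = (1/2) *\<^sub>R edge_form E p p"
proof (rule simple_graph_eqI[OF assms])
  show "edge_fun E p $ {i, j} = ((1/2) *\<^sub>R edge_form E p p) $ {i, j}" if "{i, j} \<in> E" for i j
    using that by (simp add: edge_form_edge) 
      (simp add: edge_fun_def edge_sqlen_doubleton power2_norm_eq_inner)
qed (simp_all add: edge_form_nonedge edge_fun_def)

lemma edge_form_commute: "edge_form E p u = edge_form E u p"
  by (simp add: edge_form_def algebra_simps)

lemma edge_fun_has_derivative: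
  fixes p :: "'a::euclidean_space ^ 'v::finite"
  assumes "simple_graph E"
  shows "(edge_fun E has_derivative edge_form E p) (at p)"
proof -
  note B = bounded_bilinear.FDERIV[OF bounded_bilinear_edge_form[OF assms]]
  have "((\<lambda>x :: 'a ^ 'v. (1/2) *\<^sub>R edge_form E x x) has_derivative
      (\<lambda>h. (1/2) *\<^sub>R (edge_form E p h + edge_form E h p))) (at p)"
    by (intro has_derivative_scaleR_right B has_derivative_ident)
  moreover have "(1/2) *\<^sub>R (edge_form E p h + edge_form E h p) = edge_form E p h" for h
    by (simp add: edge_form_commute[of E h p] scaleR_2[symmetric])
  moreover have "edge_fun E = (\<lambda>x :: 'a ^ 'v. (1/2) *\<^sub>R edge_form E x x)"
    using edge_form_self[OF assms] by blast
  ultimately show ?thesis by (simp only:)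
qed

lemma rank_diff_on_edge_fun:
  assumes "simple_graph E" "subspace W" "p \<in> W"
  shows "rank_diff_on W (edge_fun E) p = dim (edge_form E p ` W)"
  using rank_diff_on_eq[OF edge_fun_has_derivative[OF assms(1)] assms(2,3)] .

lemma edge_form_eq_0_iff:
  assumes "simple_graph E"
  shows "edge_form E p u = 0 \<longleftrightarrow> (\<forall>i j. {i, j} \<in> E \<longrightarrow> (p $ i - p $ j) \<bullet> (u $ i - u $ j) = 0)"
proof
  assume "edge_form E p u = 0"
  then show "\<forall>i j. {i, j} \<in> E \<longrightarrow> (p $ i - p $ j) \<bullet> (u $ i - u $ j) = 0"
    using edge_form_edge[of _ _ E p u] by fastforce
next
  assume "\<forall>i j. {i, j} \<in> E \<longrightarrow> (p $ i - p $ j) \<bullet> (u $ i - u $ j) = 0"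
  then show "edge_form E p u = 0"
    by (intro simple_graph_eqI[OF assms]) (auto simp: edge_form_edge edge_form_nonedge)
qed

lemma dim_range_rigidity_map:
  fixes p :: "'a::euclidean_space ^ 'v::finite"
  assumes "simple_graph E"
  shows "dim (range (rigidity_map E p)) = dim (range (edge_form E p))"
proof -
  have "frechet_derivative (edge_fun E) (at p) = edge_form E p"
    using frechet_derivative_at[OF edge_fun_has_derivative[OF assms]] ..
  then have "range (rigidity_map E p) = (\<lambda>x. (1/2) *\<^sub>R x) ` range (edge_form E p)"
    by (auto simp: rigidity_map_def)
  moreover have "linear (\<lambda>x::real ^ 'v set. (1/2) *\<^sub>R x)" by (simp add: linear_scaleR)
  ultimately show ?thesis
    by (simp add: dim_image_eq inj_on_def)
qed

section \<open>Cone graphs and symmetric configurations\<close>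

lemma simple_graph_cone:
  assumes "simple_graph E"
  shows "simple_graph (cone_graph E)"
  using assms by (auto simp: simple_graph_def cone_graph_def card_image)

lemma cone_graph_edge_simps [simp]:
  "{Some i, Some j} \<in> cone_graph E \<longleftrightarrow> {i, j} \<in> E"
  "{None, Some i} \<in> cone_graph E"
  "{Some i, None} \<in> cone_graph E"
  "{None} \<notin> cone_graph E"
proof -
  have "{Some i, Some j} = Some ` {i, j}" by simp
  then show "{Some i, Some j} \<in> cone_graph E \<longleftrightarrow> {i, j} \<in> E"
    unfolding cone_graph_def
    by (smt (verit) UnE UnI1 doubleton_eq_iff image_iff inj_Some inj_image_eq_iff
        mem_Collect_eq option.distinct(1))
qed (auto simp: cone_graph_def)

lemma subspace_sym_configs:
  assumes "\<And>x. x \<in> S \<Longrightarrow> linear x"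
  shows "subspace (sym_configs S \<Phi>)"
  using assms by (auto simp: sym_configs_def subspace_def linear_0 linear_add linear_scale)

lemma subspace_origin_configs: "subspace origin_configs"
  by (auto simp: origin_configs_def subspace_def)

text \<open>
  The maps \<open>\<Phi>\<close> and \<open>\<Psi>\<close> play the role of the types of a framework and of its cone: they agree on
  the vertices of \<open>G\<close>, and \<open>\<Psi>\<close> fixes the cone joint. Neither a group structure on \<open>S\<close> nor the
  automorphism property of the vertex maps is required; with \<open>S\<close> empty, there is no symmetry
  constraint.
\<close>

locale cone_type =
  fixes E :: "'v::finite set set"
    and S :: "('a::euclidean_space \<Rightarrow> 'a) set"
    and \<Phi> :: "('a \<Rightarrow> 'a) \<Rightarrow> 'v \<Rightarrow> 'v"
    and \<Psi> :: "('a \<times> real \<Rightarrow> 'a \<times> real) \<Rightarrow> 'v option \<Rightarrow> 'v option"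
  assumes simple: "simple_graph E"
    and orth: "x \<in> S \<Longrightarrow> orthogonal_transformation x"
    and type_None: "x \<in> S \<Longrightarrow> \<Psi> (map_prod x id) None = None"
    and type_Some: "x \<in> S \<Longrightarrow> \<Psi> (map_prod x id) (Some i) = Some (\<Phi> x i)"
begin

text \<open>The spaces of symmetric configurations of \<open>G\<close>, and of those of \<open>G*o\<close> with the cone joint
  at the origin.\<close>

definition base_configs :: "('a ^ 'v) set" where
  "base_configs = sym_configs S \<Phi>"

definition cone_configs :: "(('a \<times> real) ^ ('v option)) set" where
  "cone_configs = sym_configs (star_group S) \<Psi> \<inter> origin_configs"

lemma linear_sym: "x \<in> S \<Longrightarrow> linear x"
  using orth orthogonal_transformation_linear by blast

lemma linear_star: "y \<in> star_group S \<Longrightarrow> linear y"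
  by (auto simp: star_group_def intro!: linearI
      simp: linear_add linear_scale linear_sym)

lemma mem_base_configs:
  "w \<in> base_configs \<longleftrightarrow> (\<forall>x\<in>S. \<forall>i. x (w $ i) = w $ \<Phi> x i)"
  by (simp add: base_configs_def sym_configs_def)

lemma mem_cone_configs:
  "u \<in> cone_configs \<longleftrightarrow> u $ None = 0 \<and>
    (\<forall>x\<in>S. \<forall>i. x (fst (u $ Some i)) = fst (u $ Some (\<Phi> x i)) \<and>
               snd (u $ Some (\<Phi> x i)) = snd (u $ Some i))"
  unfolding cone_configs_def sym_configs_def star_group_def origin_configs_def
  by (auto simp: split_option_all type_None type_Some linear_0 linear_sym prod_eq_iff)

lemma subspace_base: "subspace base_configs"
  unfolding base_configs_def by (intro subspace_sym_configs linear_sym)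

lemma subspace_cone: "subspace cone_configs"
  unfolding cone_configs_def
  by (intro subspace_inter subspace_sym_configs subspace_origin_configs linear_star)

text \<open>The velocity of the cone framework induced by a velocity \<open>w\<close> of \<open>(G, p)\<close>; here \<open>\<alpha>\<close> holds the
  scaling factors of the cone configuration. The last coordinate makes the velocity at each joint
  orthogonal to its cone edge.\<close>

definition cone_flex :: "('v \<Rightarrow> real) \<Rightarrow> 'a ^ 'v \<Rightarrow> 'a ^ 'v \<Rightarrow> ('a \<times> real) ^ ('v option)" where
  "cone_flex \<alpha> p w =
     (\<chi> k. case k of None \<Rightarrow> 0 | Some i \<Rightarrow> \<alpha> i *\<^sub>R (w $ i, - (p $ i \<bullet> w $ i)))"

lemma cone_flex_nth [simp]:
  "cone_flex \<alpha> p w $ None = 0"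
  "cone_flex \<alpha> p w $ Some i = \<alpha> i *\<^sub>R (w $ i, - (p $ i \<bullet> w $ i))"
  by (simp_all add: cone_flex_def)

lemma linear_cone_flex: "linear (cone_flex \<alpha> p)"
  by (rule linearI) (auto simp: vec_eq_iff split_option_all inner_simps algebra_simps)

lemma cone_kernel_eq:
  assumes p: "p \<in> base_configs" and q: "q \<in> cone_configs"
    and \<alpha>: "\<And>i. \<alpha> i \<noteq> 0" "\<And>i. q $ Some i = \<alpha> i *\<^sub>R (p $ i, 1)"
  shows "{u\<in>cone_configs. edge_form (cone_graph E) q u = 0} =
    cone_flex \<alpha> p ` {w\<in>base_configs. edge_form E p w = 0}"
proof -
  have q0: "q $ None = 0" using q by (simp add: mem_cone_configs)
  have \<alpha>_orbit: "\<alpha> (\<Phi> x i) = \<alpha> i" if "x \<in> S" for x i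
    using q that by (simp add: mem_cone_configs \<alpha>(2))
  have isom: "x a \<bullet> x b = a \<bullet> b" if "x \<in> S" for x a b
    using orth[OF that] by (simp add: orthogonal_transformation_def)
  have symmetric: "cone_flex \<alpha> p w \<in> cone_configs \<longleftrightarrow> w \<in> base_configs" for w
  proof -
    have "x (fst (cone_flex \<alpha> p w $ Some i)) = fst (cone_flex \<alpha> p w $ Some (\<Phi> x i)) \<and>
        snd (cone_flex \<alpha> p w $ Some (\<Phi> x i)) = snd (cone_flex \<alpha> p w $ Some i) \<longleftrightarrow>
        x (w $ i) = w $ \<Phi> x i" (is "?fst \<and> ?snd \<longleftrightarrow> ?w") if x: "x \<in> S" for x i
    proof -
      have "?fst \<longleftrightarrow> ?w"
        using \<alpha>(1)[of i] by (simp add: \<alpha>_orbit[OF x] linear_scale[OF linear_sym[OF x]])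
      moreover have "?snd" if "?w"
        using isom[OF x, of "p $ i" "w $ i"] p x that by (simp add: \<alpha>_orbit[OF x] mem_base_configs)
      ultimately show ?thesis by blast
    qed
    then show ?thesis
      unfolding mem_cone_configs mem_base_configs by (simp del: cone_flex_nth(2))
  qed
  have flex: "edge_form (cone_graph E) q (cone_flex \<alpha> p w) = 0 \<longleftrightarrow> edge_form E p w = 0" for w
  proof -
    have "(q $ Some i - q $ Some j) \<bullet> (cone_flex \<alpha> p w $ Some i - cone_flex \<alpha> p w $ Some j)
        = (\<alpha> i * \<alpha> j) * ((p $ i - p $ j) \<bullet> (w $ i - w $ j))" for i j
      by (simp add: \<alpha>(2) inner_simps inner_commute algebra_simps)
    moreover have "q $ Some i \<bullet> cone_flex \<alpha> p w $ Some i = 0" for i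
      by (simp add: \<alpha>(2) inner_simps)
    ultimately show ?thesis
      unfolding edge_form_eq_0_iff[OF simple] edge_form_eq_0_iff[OF simple_graph_cone[OF simple]]
      by (simp add: split_option_all q0 \<alpha>(1) inner_minus_left del: cone_flex_nth(2))
  qed
  have "\<exists>w. u = cone_flex \<alpha> p w"
    if u: "u \<in> cone_configs" "edge_form (cone_graph E) q u = 0" for u
  proof -
    define w where "w = (\<chi> i. (1 / \<alpha> i) *\<^sub>R fst (u $ Some i))"
    have u0: "u $ None = 0" using u(1) by (simp add: mem_cone_configs)
    have "q $ Some i \<bullet> u $ Some i = 0" for i
      using u(2) cone_graph_edge_simps(3)[of i E] u0 q0
      unfolding edge_form_eq_0_iff[OF simple_graph_cone[OF simple]] by fastforce
    then have "\<alpha> i * (p $ i \<bullet> fst (u $ Some i) + snd (u $ Some i)) = 0" for i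
      by (simp add: \<alpha>(2) inner_prod_def distrib_left)
    then have "p $ i \<bullet> fst (u $ Some i) + snd (u $ Some i) = 0" for i
      using \<alpha>(1) by (meson mult_eq_0_iff)
    then have "u $ Some i = cone_flex \<alpha> p w $ Some i" for i
      using \<alpha>(1)[of i] by (simp add: w_def prod_eq_iff eq_neg_iff_add_eq_0 add.commute)
    then have "u = cone_flex \<alpha> p w" using u0 by (simp add: vec_eq_iff split_option_all)
    then show ?thesis ..
  qed
  then show ?thesis using symmetric flex by blast
qed

theorem cone_rank:
  assumes p: "p \<in> base_configs" and q: "q \<in> cone_configs" and proj: "cone_projects_to q p"
  shows "rank_diff_on cone_configs (edge_fun (cone_graph E)) q + dim base_configs =
    rank_diff_on base_configs (edge_fun E) p + dim cone_configs"
proof -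
  obtain \<alpha> where \<alpha>: "\<And>i. \<alpha> i \<noteq> 0" "\<And>i. q $ Some i = \<alpha> i *\<^sub>R (p $ i, 1)"
    using proj unfolding cone_projects_to_def by metis
  have inj: "inj (cone_flex \<alpha> p)"
  proof (rule injI)
    fix v w assume "cone_flex \<alpha> p v = cone_flex \<alpha> p w"
    then have "cone_flex \<alpha> p v $ Some i = cone_flex \<alpha> p w $ Some i" for i by simp
    then show "v = w" using \<alpha>(1) by (simp add: vec_eq_iff)
  qed
  have lin: "linear (edge_form H r)" if "simple_graph H"
    for H :: "'z::finite set set" and r :: "'y::euclidean_space ^ 'z"
    using bounded_bilinear.bounded_linear_right[OF bounded_bilinear_edge_form[OF that]]
    by (rule bounded_linear.linear)
  have "dim {u\<in>cone_configs. edge_form (cone_graph E) q u = 0}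
      = dim {w\<in>base_configs. edge_form E p w = 0}"
    unfolding cone_kernel_eq[OF p q \<alpha>]
    by (rule dim_image_eq[OF linear_cone_flex inj_on_subset[OF inj subset_UNIV]])
  then show ?thesis
    using rank_nullity_on[OF lin[OF simple] subspace_base, of p]
      rank_nullity_on[OF lin[OF simple_graph_cone[OF simple]] subspace_cone, of q]
      rank_diff_on_edge_fun[OF simple subspace_base p]
      rank_diff_on_edge_fun[OF simple_graph_cone[OF simple] subspace_cone q]
    by linarith
qed

section \<open>Comparison of the maximal ranks\<close>

text \<open>
  Translating all joints of \<open>G\<close> by \<open>(0, \<epsilon>)\<close>, which every \<open>x\<^sup>*\<close> fixes, makes all the last
  coordinates nonzero for all small \<open>\<epsilon> > 0\<close>.
\<close>

lemma projectable_perturbation: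
  assumes q: "q \<in> cone_configs"
  obtains q' p' where "q' \<in> cone_configs" "p' \<in> base_configs" "cone_projects_to q' p'"
    "rank_diff_on cone_configs (edge_fun (cone_graph E)) q \<le>
     rank_diff_on cone_configs (edge_fun (cone_graph E)) q'"
proof -
  define c :: "('a \<times> real) ^ ('v option)"
    where "c = (\<chi> k. case k of None \<Rightarrow> 0 | Some i \<Rightarrow> (0, 1))"
  have c_nth [simp]: "c $ None = 0" "c $ Some i = (0, 1)" for i by (simp_all add: c_def)
  have c: "c \<in> cone_configs" by (simp add: mem_cone_configs linear_0 linear_sym)
  have simple': "simple_graph (cone_graph E)" using simple by (rule simple_graph_cone)
  obtain \<delta> where \<delta>: "\<delta> > 0" "\<And>h. norm h < \<delta> \<Longrightarrow>
      dim (edge_form (cone_graph E) q ` cone_configs)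
      \<le> dim (edge_form (cone_graph E) (q + h) ` cone_configs)"
    using rank_bilinear_lower_semicontinuous[OF bounded_bilinear_edge_form[OF simple'] subspace_cone]
    by metis
  have "\<forall>\<^sub>F \<epsilon> in at_right 0. norm (\<epsilon> *\<^sub>R c) < \<delta>"
    by (rule order_tendstoD(2)[OF _ \<delta>(1)]) (auto intro!: tendsto_eq_intros)
  moreover have "\<forall>\<^sub>F \<epsilon> in at_right 0. \<epsilon> \<noteq> - snd (q $ Some i)" for i
  proof (cases "snd (q $ Some i) = 0")
    case True
    then show ?thesis using eventually_at_right_less[of 0] by (auto elim: eventually_mono)
  next
    case False
    then show ?thesis by (intro tendsto_imp_eventually_ne[of _ 0]) auto
  qed
  then have "\<forall>\<^sub>F \<epsilon> in at_right 0. \<forall>i. \<epsilon> \<noteq> - snd (q $ Some i)"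
    by (rule eventually_all_finite)
  ultimately have "\<forall>\<^sub>F \<epsilon> in at_right 0. norm (\<epsilon> *\<^sub>R c) < \<delta> \<and> (\<forall>i. \<epsilon> \<noteq> - snd (q $ Some i))"
    by eventually_elim blast
  then obtain \<epsilon> where \<epsilon>: "norm (\<epsilon> *\<^sub>R c) < \<delta>" "\<And>i. \<epsilon> \<noteq> - snd (q $ Some i)"
    using eventually_happens'[OF trivial_limit_at_right_real] by blast
  define q' where "q' = q + \<epsilon> *\<^sub>R c"
  define p' where "p' = (\<chi> i. (1 / snd (q' $ Some i)) *\<^sub>R fst (q' $ Some i))"
  have q': "q' \<in> cone_configs"
    using q c by (simp add: q'_def subspace_add subspace_scale subspace_cone)
  have nz: "snd (q' $ Some i) \<noteq> 0" for i
    using \<epsilon>(2)[of i] by (auto simp: q'_def)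
  have "p' \<in> base_configs"
    using q' by (simp add: mem_cone_configs mem_base_configs p'_def linear_scale linear_sym)
  moreover have "cone_projects_to q' p'"
    unfolding cone_projects_to_def
  proof (intro conjI allI)
    show "q' $ None = 0" using q' by (simp add: mem_cone_configs)
    show "\<exists>\<alpha>. \<alpha> \<noteq> 0 \<and> q' $ Some i = \<alpha> *\<^sub>R (p' $ i, 1)" for i
      using nz[of i] by (intro exI[of _ "snd (q' $ Some i)"]) (simp add: p'_def prod_eq_iff)
  qed
  moreover have "rank_diff_on cone_configs (edge_fun (cone_graph E)) q
      \<le> rank_diff_on cone_configs (edge_fun (cone_graph E)) q'"
    using \<delta>(2)[OF \<epsilon>(1)] rank_diff_on_edge_fun[OF simple' subspace_cone q]
      rank_diff_on_edge_fun[OF simple' subspace_cone q'] by (simp add: q'_def)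
  ultimately show ?thesis using that q' by blast
qed

lemma spherical_lift:
  assumes p: "p \<in> base_configs"
  obtains q :: "('a \<times> real) ^ ('v option)"
  where "q \<in> cone_configs" "cone_projects_to q p" "\<And>i. q $ Some i \<in> sphere 0 1"
proof -
  define \<alpha> where "\<alpha> i = 1 / norm (p $ i, 1::real)" for i
  define q :: "('a \<times> real) ^ ('v option)"
    where "q = (\<chi> k. case k of None \<Rightarrow> 0 | Some i \<Rightarrow> \<alpha> i *\<^sub>R (p $ i, 1))"
  have q_nth [simp]: "q $ None = 0" "q $ Some i = \<alpha> i *\<^sub>R (p $ i, 1)" for i
    by (simp_all add: q_def)
  have nz: "(p $ i, 1::real) \<noteq> 0" for i by (simp add: zero_prod_def)
  have "norm (x a) = norm a" if "x \<in> S" for x a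
    using orth[OF that] by (simp add: orthogonal_transformation_norm)
  then have "\<alpha> (\<Phi> x i) = \<alpha> i" if "x \<in> S" for x i
    using p that by (metis \<alpha>_def mem_base_configs norm_Pair)
  then have "q \<in> cone_configs"
    using p by (simp add: mem_cone_configs mem_base_configs linear_scale linear_sym)
  moreover have "cone_projects_to q p"
    unfolding cone_projects_to_def using nz by (auto simp: \<alpha>_def)
  moreover have "q $ Some i \<in> sphere 0 1" for i
    using nz[of i] by (simp add: \<alpha>_def del: scaleR_Pair)
  ultimately show ?thesis using that by blast
qed

lemma cone_maximal_if_base_maximal:
  assumes p: "p \<in> base_configs" and q: "q \<in> cone_configs" and proj: "cone_projects_to q p"
    and max: "\<forall>p'\<in>base_configs. rank_diff_on base_configs (edge_fun E) p'
      \<le> rank_diff_on base_configs (edge_fun E) p"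
    and r: "r \<in> cone_configs"
  shows "rank_diff_on cone_configs (edge_fun (cone_graph E)) r
    \<le> rank_diff_on cone_configs (edge_fun (cone_graph E)) q"
proof -
  obtain q' p' where *: "q' \<in> cone_configs" "p' \<in> base_configs" "cone_projects_to q' p'"
    "rank_diff_on cone_configs (edge_fun (cone_graph E)) r \<le>
     rank_diff_on cone_configs (edge_fun (cone_graph E)) q'"
    using projectable_perturbation[OF r] by blast
  show ?thesis
    using *(4) cone_rank[OF *(2,1,3)] cone_rank[OF p q proj] max[rule_format, OF *(2)] by linarith
qed

lemma base_maximal_if_sphere_maximal:
  assumes p: "p \<in> base_configs" and q: "q \<in> cone_configs" and proj: "cone_projects_to q p"
    and max: "\<forall>q'\<in>cone_configs. (\<forall>i. q' $ Some i \<in> sphere 0 1) \<longrightarrow>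
      rank_diff_on cone_configs (edge_fun (cone_graph E)) q'
      \<le> rank_diff_on cone_configs (edge_fun (cone_graph E)) q"
    and r: "r \<in> base_configs"
  shows "rank_diff_on base_configs (edge_fun E) r \<le> rank_diff_on base_configs (edge_fun E) p"
proof -
  obtain q' where *: "q' \<in> cone_configs" "cone_projects_to q' r" "\<forall>i. q' $ Some i \<in> sphere 0 1"
    using spherical_lift[OF r] by blast
  show ?thesis
    using cone_rank[OF r *(1,2)] cone_rank[OF p q proj] max[rule_format, OF *(1)] *(3) by force
qed

theorem cone_maximal_iff:
  assumes "p \<in> base_configs" "q \<in> cone_configs" "cone_projects_to q p"
  shows "(\<forall>p'\<in>base_configs. rank_diff_on base_configs (edge_fun E) p'
        \<le> rank_diff_on base_configs (edge_fun E) p) \<longleftrightarrow>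
      (\<forall>q'\<in>cone_configs. rank_diff_on cone_configs (edge_fun (cone_graph E)) q'
        \<le> rank_diff_on cone_configs (edge_fun (cone_graph E)) q)"
    and "(\<forall>p'\<in>base_configs. rank_diff_on base_configs (edge_fun E) p'
        \<le> rank_diff_on base_configs (edge_fun E) p) \<longleftrightarrow>
      (\<forall>q'\<in>cone_configs. (\<forall>i. q' $ Some i \<in> sphere 0 1) \<longrightarrow>
        rank_diff_on cone_configs (edge_fun (cone_graph E)) q'
        \<le> rank_diff_on cone_configs (edge_fun (cone_graph E)) q)"
  using cone_maximal_if_base_maximal[OF assms] base_maximal_if_sphere_maximal[OF assms] by blast+

end

section \<open>The types of a framework and of its cone\<close>

lemma is_framework_type_framework_type:
  "p \<in> sym_frameworks E S \<Longrightarrow> is_framework_type E S p (framework_type E S p)"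
  unfolding framework_type_def by (rule theI'[OF framework_type_unique])

text \<open>
  By injectivity, the cone joint is the only joint at the origin, so it is fixed; and two joints of
  the cone framework that project to the same point coincide.
\<close>

lemma cone_type_framework_types:
  assumes E: "simple_graph E" and S: "symmetry_group S" and proj: "cone_projects_to q p"
    and p: "p \<in> sym_frameworks E S"
    and q: "q \<in> sym_frameworks (cone_graph E) (star_group S)"
  shows "cone_type E S (framework_type E S p)
    (framework_type (cone_graph E) (star_group S) q)"
proof -
  let ?\<Phi> = "framework_type E S p" and ?\<Psi> = "framework_type (cone_graph E) (star_group S) q"
  have orth: "orthogonal_transformation x" if "x \<in> S" for x
    using S that by (auto simp: symmetry_group_def)
  have \<Phi>: "x (p $ i) = p $ ?\<Phi> x i" if "x \<in> S" for x i
    using is_framework_type_framework_type[OF p] that by (simp add: is_framework_type_def)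
  have \<Psi>: "map_prod x id (q $ k) = q $ ?\<Psi> (map_prod x id) k" if "x \<in> S" for x k
    using is_framework_type_framework_type[OF q] that
    by (simp add: is_framework_type_def star_group_def)
  have inj_p: "p $ i = p $ j \<Longrightarrow> i = j" for i j
    using p by (auto simp: sym_frameworks_def inj_def)
  have inj_q: "q $ k = q $ l \<Longrightarrow> k = l" for k l
    using q by (auto simp: sym_frameworks_def inj_def)
  obtain \<alpha> where q0: "q $ None = 0"
    and \<alpha>: "\<And>i. \<alpha> i \<noteq> 0" "\<And>i. q $ Some i = \<alpha> i *\<^sub>R (p $ i, 1)"
    using proj unfolding cone_projects_to_def by metis
  have lin: "linear x" if "x \<in> S" for x
    using orth[OF that] by (rule orthogonal_transformation_linear)
  show ?thesis
  proof
    fix x assume x: "x \<in> S"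
    have "q $ ?\<Psi> (map_prod x id) None = q $ None"
      using \<Psi>[OF x, of None] q0 lin[OF x] by (simp add: zero_prod_def linear_0)
    then show None: "?\<Psi> (map_prod x id) None = None" by (rule inj_q)
    fix i
    have eq: "q $ ?\<Psi> (map_prod x id) (Some i) = \<alpha> i *\<^sub>R (p $ ?\<Phi> x i, 1)"
      using \<Psi>[OF x, of "Some i"] \<Phi>[OF x, of i] lin[OF x] by (simp add: \<alpha>(2) linear_scale)
    show "?\<Psi> (map_prod x id) (Some i) = Some (?\<Phi> x i)"
    proof (cases "?\<Psi> (map_prod x id) (Some i)")
      case None
      then show ?thesis using eq q0 \<alpha>(1)[of i] by (simp add: zero_prod_def)
    next
      case (Some j)
      then have "p $ j = p $ ?\<Phi> x i"
        using eq \<alpha>(1)[of i] by (auto simp: \<alpha>(2))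
      then show ?thesis using Some inj_p by blast
    qed
  qed (use E orth in auto)
qed

section \<open>Regularity under coning\<close>

theorem theorem4p1:
  fixes E :: "'n::finite set set"
    and p :: "(real ^ 'd) ^ 'n"
    and q :: "((real ^ 'd) \<times> real) ^ ('n option)"
    and S :: "(real ^ 'd \<Rightarrow> real ^ 'd) set"
  assumes "simple_graph E"
    and "cone_projects_to q p"
    and "symmetry_group S"
  shows "(regular_point E p \<longleftrightarrow> cone_regular_point E q) \<and>
    (p \<in> sym_frameworks E S \<and> q \<in> sym_frameworks (cone_graph E) (star_group S) \<longrightarrow>
      (sym_regular_point E S p \<longleftrightarrow> cone_sym_regular_point E (star_group S) q)) \<and>
    (p \<in> sym_frameworks E S \<and> q \<in> sym_frameworks (cone_graph E) (star_group S) \<and>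
      (\<forall>i. q $ Some i \<in> upper_sphere) \<longrightarrow>
      (sym_regular_point E S p \<longleftrightarrow> sphere_sym_regular_point E (star_group S) q))"
proof (intro conjI impI)
  have q0: "q \<in> origin_configs"
    using assms(2) by (simp add: cone_projects_to_def origin_configs_def)
  show "regular_point E p \<longleftrightarrow> cone_regular_point E q"
  proof -
    \<comment> \<open>Without symmetry constraints, the types play no role.\<close>
    interpret cone_type E "{} :: (real ^ 'd \<Rightarrow> real ^ 'd) set" "\<lambda>_. id" "\<lambda>_. id"
      using assms(1) by unfold_locales auto
    have base: "base_configs = UNIV" by (simp add: base_configs_def sym_configs_def)
    have cone: "cone_configs = origin_configs"
      by (simp add: cone_configs_def sym_configs_def star_group_def)
    have "dim (range (rigidity_map E p')) = rank_diff_on UNIV (edge_fun E) p'"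
      for p' :: "(real ^ 'd) ^ 'n"
      by (simp add: dim_range_rigidity_map rank_diff_on_edge_fun assms(1))
    then show ?thesis
      using cone_maximal_iff(1)[of p q] q0 assms(2)
      by (simp add: base cone regular_point_def cone_regular_point_def Let_def)
  qed
  let ?\<Phi> = "framework_type E S p" and ?\<Psi> = "framework_type (cone_graph E) (star_group S) q"
  {
    assume p: "p \<in> sym_frameworks E S"
      and q: "q \<in> sym_frameworks (cone_graph E) (star_group S)"
    interpret cone_type E S ?\<Phi> ?\<Psi>
      using cone_type_framework_types[OF assms(1,3,2) p q] .
    have pB: "p \<in> base_configs"
      using is_framework_type_framework_type[OF p]
      by (simp add: mem_base_configs is_framework_type_def)
    have qC: "q \<in> cone_configs"
      using is_framework_type_framework_type[OF q] q0
      by (simp add: cone_configs_def sym_configs_def is_framework_type_def)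
    have "sym_regular_point E S p \<longleftrightarrow> cone_sym_regular_point E (star_group S) q"
      "sym_regular_point E S p \<longleftrightarrow> sphere_sym_regular_point E (star_group S) q"
      using cone_maximal_iff[OF pB qC assms(2)]
      by (simp_all add: base_configs_def cone_configs_def sym_regular_point_def
          cone_sym_regular_point_def sphere_sym_regular_point_def Let_def)
  }
  note symmetric = this
  show "sym_regular_point E S p \<longleftrightarrow> cone_sym_regular_point E (star_group S) q"
    if "p \<in> sym_frameworks E S \<and> q \<in> sym_frameworks (cone_graph E) (star_group S)"
    using symmetric(1) that by blast
  show "sym_regular_point E S p \<longleftrightarrow> sphere_sym_regular_point E (star_group S) q"
    if "p \<in> sym_frameworks E S \<and> q \<in> sym_frameworks (cone_graph E) (star_group S) \<and>
      (\<forall>i. q $ Some i \<in> upper_sphere)"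
    using symmetric(2) that by blast
qed

end
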